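(* Let $n\ge1$ and let $B_1,\dots,B_{n+1}$ be independent standard Brownian motions. Define $\mathcal{I}_n(t)=B_1(|B_2(|B_3(\cdots(|B_{n+1}(t)|)\cdots)|)|)$, $t>0$. Then for $\beta>0$, \begin{align*} \Pr\Big\{\max_{0\le s\le t}\mathcal{I}_n(s)\in d\beta\Big\} =2\int_0^{\infty}\!\!\cdots\!\int_0^{\infty}&\Pr\{B_1(y_1)\in d\beta\}\,\Pr\Big\{\max_{0\le z_1\le y_2}|B_2(z_1)|\in dy_1\Big\}\\ &\times\Pr\Big\{\max_{0\le z_2\le y_3}|B_3(z_2)|\in dy_2\Big\}\cdots\Pr\Big\{\max_{0\le z_n\le t}|B_{n+1}(z_n)|\in dy_n\Big\}. \end{align*}
   Context: $\mathcal{I}_n$ is the $n$-times iterated Brownian motion; the integrals are over $y_1,\dots,y_n\in(0,\infty)$. *)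

theory Defs
  imports "HOL-Probability.Probability"
begin

definition std_brownian_motion :: "'a measure \<Rightarrow> (real \<Rightarrow> 'a \<Rightarrow> real) \<Rightarrow> bool" where
  "std_brownian_motion M B \<longleftrightarrow>
     prob_space M \<and>
     (\<forall>t\<ge>0. B t \<in> borel_measurable M) \<and>
     (\<forall>\<omega>\<in>space M. B 0 \<omega> = 0 \<and> continuous_on {0..} (\<lambda>t. B t \<omega>)) \<and>
     (\<forall>(ts :: nat \<Rightarrow> real) k. ts 0 \<ge> 0 \<and> strict_mono ts \<longrightarrow>
        prob_space.indep_vars M (\<lambda>_. borel) (\<lambda>i \<omega>. B (ts (Suc i)) \<omega> - B (ts i) \<omega>) {..<k}) \<and>
     (\<forall>s t. 0 \<le> s \<and> s < t \<longrightarrow>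
        distributed M lborel (\<lambda>\<omega>. B t \<omega> - B s \<omega>) (normal_density 0 (sqrt (t - s))))"

definition indep_processes :: "'a measure \<Rightarrow> (nat \<Rightarrow> real \<Rightarrow> 'a \<Rightarrow> real) \<Rightarrow> nat set \<Rightarrow> bool" where
  "indep_processes M B I \<longleftrightarrow>
     prob_space.indep_vars M (\<lambda>_. \<Pi>\<^sub>M t\<in>{0::real..}. (borel :: real measure))
        (\<lambda>k \<omega>. restrict (\<lambda>t. B k t \<omega>) {0..}) I"

text \<open>Iterated composition: itbm B k m x = B_k(|B_(k+1)(| ... |B_(k+m)(x)| ...)|).
  Hence the n-times iterated Brownian motion is I_n(s) = itbm B 1 n s.\<close>
fun itbm :: "(nat \<Rightarrow> real \<Rightarrow> 'a \<Rightarrow> real) \<Rightarrow> nat \<Rightarrow> nat \<Rightarrow> real \<Rightarrow> 'a \<Rightarrow> real" where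
  "itbm B k 0 x \<omega> = B k x \<omega>"
| "itbm B k (Suc m) x \<omega> = B k \<bar>itbm B (Suc k) m x \<omega>\<bar> \<omega>"

definition absmax :: "(nat \<Rightarrow> real \<Rightarrow> 'a \<Rightarrow> real) \<Rightarrow> nat \<Rightarrow> real \<Rightarrow> 'a \<Rightarrow> real" where
  "absmax B k y \<omega> = (SUP z\<in>{0..y}. \<bar>B k z \<omega>\<bar>)"

text \<open>The right-hand side as an iterated kernel (measure form of the density identity):
  rhs_kernel M B A 1 y = Pr{B_1(y) in A},
  rhs_kernel M B A (k+1) y = int_(0,oo) rhs_kernel M B A k y' Pr{max_(0<=z<=y)|B_(k+1)(z)| in dy'}.\<close>
fun rhs_kernel :: "'a measure \<Rightarrow> (nat \<Rightarrow> real \<Rightarrow> 'a \<Rightarrow> real) \<Rightarrow> real set \<Rightarrow> nat \<Rightarrow> real \<Rightarrow> real" where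
  "rhs_kernel M B A 0 y = 0"
| "rhs_kernel M B A (Suc 0) y = measure M {\<omega>\<in>space M. B 1 y \<omega> \<in> A}"
| "rhs_kernel M B A (Suc (Suc k)) y =
     (LINT y' : {0<..} | distr M borel (absmax B (Suc (Suc k)) y). rhs_kernel M B A (Suc k) y')"

end

theory Submission
  imports Defs
begin

text \<open>
  Each path \<open>\<bar>B\<^sub>k\<bar>\<close> starts at \<open>0\<close> and is continuous, so it maps \<open>[0, y]\<close> onto \<open>[0, max \<bar>B\<^sub>k\<bar>]\<close>. Hence the
  maximum of the iterated process over \<open>[0, t]\<close> is the maximum of \<open>B\<^sub>1\<close> over \<open>[0, Y]\<close>, where \<open>Y\<close> is a
  nested maximum depending only on \<open>B\<^sub>2, ..., B\<^bsub>n+1\<^esub>\<close>. By independence and Fubini the law of the maximum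
  is a composition of kernels, and the reflection principle for \<open>B\<^sub>1\<close> contributes the factor \<open>2\<close>.
  The reflection principle itself is obtained without the strong Markov property: on a finite grid it
  is the invariance of the increments under sign flips after the first passage, and the overshoot
  vanishes as the grid is refined.
\<close>

section \<open>Reflection for random walks\<close>

text \<open>Independence makes the joint law the product of the marginals, and a symmetric marginal
  does not see the sign. The flipped set \<open>J\<close> is deterministic; a random flip time is
  handled later by splitting over its values.\<close>

lemma (in prob_space) prob_sign_flip:
  fixes X :: "'i \<Rightarrow> 'a \<Rightarrow> real"
  assumes ind: "indep_vars (\<lambda>_. borel) X I" and I: "I \<noteq> {}"
    and sym: "\<And>i. i \<in> I \<Longrightarrow> distr M borel (\<lambda>\<omega>. - X i \<omega>) = distr M borel (X i)"
    and C: "C \<in> sets (\<Pi>\<^sub>M i\<in>I. (borel :: real measure))"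
  shows "\<P>(\<omega> in M. (\<lambda>i\<in>I. if i \<in> J then - X i \<omega> else X i \<omega>) \<in> C) = \<P>(\<omega> in M. (\<lambda>i\<in>I. X i \<omega>) \<in> C)"
proof -
  define Y where "Y i \<omega> = (if i \<in> J then - X i \<omega> else X i \<omega>)" for i \<omega>
  have rvX [measurable]: "random_variable borel (X i)" if "i \<in> I" for i
    using ind that by (auto simp: indep_vars_def)
  have rvY [measurable]: "random_variable borel (Y i)" if "i \<in> I" for i
    using that unfolding Y_def by (cases "i \<in> J") simp_all
  have indY: "indep_vars (\<lambda>_. borel) Y I"
  proof -
    have "indep_vars (\<lambda>_. borel) (\<lambda>i \<omega>. (if i \<in> J then uminus else (\<lambda>x. x)) (X i \<omega>)) I"
      by (rule indep_vars_compose2[OF ind]) simp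
    also have "(\<lambda>i \<omega>. (if i \<in> J then uminus else (\<lambda>x. x)) (X i \<omega>)) = Y"
      by (auto simp: Y_def fun_eq_iff)
    finally show ?thesis .
  qed
  have "distr M (\<Pi>\<^sub>M i\<in>I. borel) (\<lambda>\<omega>. \<lambda>i\<in>I. Y i \<omega>) = (\<Pi>\<^sub>M i\<in>I. distr M borel (Y i))"
    using iffD1[OF indep_vars_iff_distr_eq_PiM'[OF I, where M'="\<lambda>_. borel" and X=Y] indY] rvY by simp
  also have "\<dots> = (\<Pi>\<^sub>M i\<in>I. distr M borel (X i))"
  proof (intro PiM_cong refl)
    fix i assume "i \<in> I"
    then show "distr M borel (Y i) = distr M borel (X i)"
      using sym by (cases "i \<in> J") (simp_all add: Y_def [abs_def])
  qed
  also have "\<dots> = distr M (\<Pi>\<^sub>M i\<in>I. borel) (\<lambda>\<omega>. \<lambda>i\<in>I. X i \<omega>)"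
    using iffD1[OF indep_vars_iff_distr_eq_PiM'[OF I, where M'="\<lambda>_. borel" and X=X] ind] rvX by simp
  finally have eq: "measure (distr M (\<Pi>\<^sub>M i\<in>I. borel) (\<lambda>\<omega>. \<lambda>i\<in>I. Y i \<omega>)) C
      = measure (distr M (\<Pi>\<^sub>M i\<in>I. borel) (\<lambda>\<omega>. \<lambda>i\<in>I. X i \<omega>)) C" by simp
  have "(\<lambda>\<omega>. \<lambda>i\<in>I. Y i \<omega>) \<in> measurable M (\<Pi>\<^sub>M i\<in>I. borel)"
       "(\<lambda>\<omega>. \<lambda>i\<in>I. X i \<omega>) \<in> measurable M (\<Pi>\<^sub>M i\<in>I. borel)"
    by measurable
  with eq C show ?thesis
    by (simp add: measure_distr vimage_def Int_def conj_commute Y_def)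
qed

text \<open>Changing the signs of all increments after the first passage above \<open>a\<close> reflects the
  endpoint of the walk at the passage point.\<close>
lemma (in prob_space) discrete_reflection:
  fixes X :: "nat \<Rightarrow> 'a \<Rightarrow> real" and a :: real
  defines "S \<equiv> \<lambda>k \<omega>. \<Sum>i<k. X i \<omega>"
  defines "T \<equiv> \<lambda>\<omega>. LEAST i. a < S i \<omega>"
  assumes ind: "indep_vars (\<lambda>_. borel) X {..<N}" and N: "N > 0"
    and sym: "\<And>i. i < N \<Longrightarrow> distr M borel (\<lambda>\<omega>. - X i \<omega>) = distr M borel (X i)"
  shows "\<P>(\<omega> in M. (\<exists>i\<le>N. a < S i \<omega>) \<and> S N \<omega> \<le> a)
       = \<P>(\<omega> in M. (\<exists>i\<le>N. a < S i \<omega>) \<and> 2 * S (T \<omega>) \<omega> - S N \<omega> \<le> a)"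
proof -
  \<comment> \<open>First passage exactly at index \<open>j\<close>. Once \<open>j\<close> is fixed,
    the increments to be flipped form a deterministic set.\<close>
  define P where "P j \<omega> \<longleftrightarrow> a < S j \<omega> \<and> (\<forall>i\<in>{..<j}. S i \<omega> \<le> a)" for j \<omega>
  have ex: "(\<exists>i\<le>N. a < S i \<omega>) \<longleftrightarrow> (\<exists>j\<le>N. P j \<omega>)" for \<omega>
  proof
    assume "\<exists>i\<le>N. a < S i \<omega>"
    then obtain i where i: "i \<le> N" "a < S i \<omega>" by blast
    have "P (LEAST i. a < S i \<omega>) \<omega>"
      unfolding P_def using LeastI[of "\<lambda>i. a < S i \<omega>", OF i(2)] not_less_Least
      by (auto simp: not_less[symmetric])
    moreover have "(LEAST i. a < S i \<omega>) \<le> N"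
      using Least_le[of "\<lambda>i. a < S i \<omega>", OF i(2)] i(1) by simp
    ultimately show "\<exists>j\<le>N. P j \<omega>" by blast
  qed (auto simp: P_def)
  have T: "T \<omega> = j" if "P j \<omega>" for j \<omega>
    unfolding T_def using that by (intro Least_equality) (auto simp: P_def not_le[symmetric])
  have [measurable]: "random_variable borel (X i)" if "i < N" for i
    using ind that by (auto simp: indep_vars_def)
  have [measurable]: "random_variable borel (S k)" if "k \<le> N" for k
    using that unfolding S_def by (intro borel_measurable_sum) auto
  have [measurable]: "Measurable.pred M (P j)" if "j \<le> N" for j
  proof -
    have "Measurable.pred M (\<lambda>\<omega>. S i \<omega> \<le> a)" "Measurable.pred M (\<lambda>\<omega>. a < S i \<omega>)" if "i \<le> N" for i
      using that by measurable
    then show ?thesis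
      using that unfolding P_def [abs_def] by (intro pred_intros_logic pred_intros_finite) auto
  qed
  have disj: "disjoint_family_on (\<lambda>j. {\<omega>\<in>space M. P j \<omega> \<and> Q j \<omega>}) {..N}" for Q
    unfolding disjoint_family_on_def using T by blast
  have eq: "\<P>(\<omega> in M. P j \<omega> \<and> S N \<omega> \<le> a) = \<P>(\<omega> in M. P j \<omega> \<and> 2 * S j \<omega> - S N \<omega> \<le> a)" if j: "j \<le> N" for j
  proof -
    \<comment> \<open>Passage at \<open>j\<close> with endpoint at most \<open>a\<close>, written
      through the increments alone. One set serves both sides: the original increments give the
      event on the left, the flipped ones the reflected event.\<close>
    define C where "C = {x \<in> space (\<Pi>\<^sub>M i\<in>{..<N}. (borel :: real measure)).
      a < (\<Sum>i<j. x i) \<and> (\<forall>k\<in>{..<j}. (\<Sum>i<k. x i) \<le> a) \<and> (\<Sum>i<N. x i) \<le> a}"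
    have C: "C \<in> sets (\<Pi>\<^sub>M i\<in>{..<N}. (borel :: real measure))"
    proof -
      let ?P = "\<Pi>\<^sub>M i\<in>{..<N}. (borel :: real measure)"
      have [measurable]: "(\<lambda>x. \<Sum>i<k. x i) \<in> borel_measurable ?P" if "k \<le> N" for k
        using that by (intro borel_measurable_sum measurable_component_singleton) auto
      have "Measurable.pred ?P (\<lambda>x. (\<Sum>i<k. x i) \<le> a)" "Measurable.pred ?P (\<lambda>x. a < (\<Sum>i<k. x i))" if "k \<le> N" for k
        using that by measurable
      then have "Measurable.pred ?P (\<lambda>x. a < (\<Sum>i<j. x i) \<and> (\<forall>k\<in>{..<j}. (\<Sum>i<k. x i) \<le> a) \<and> (\<Sum>i<N. x i) \<le> a)"
        using j by (intro pred_intros_logic pred_intros_finite) auto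
      then show ?thesis unfolding C_def pred_def .
    qed
    \<comment> \<open>Partial sums up to \<open>j\<close> survive the flip, so the passage index
      does too; the remainder \<open>S N - S j\<close> is negated, which moves the endpoint to
      \<open>2 * S j - S N\<close>.\<close>
    have flip: "(\<lambda>i\<in>{..<N}. if i \<in> {j..} then - X i \<omega> else X i \<omega>) \<in> C \<longleftrightarrow> P j \<omega> \<and> 2 * S j \<omega> - S N \<omega> \<le> a" for \<omega>
    proof -
      define Y where "Y i = (\<lambda>i\<in>{..<N}. if i \<in> {j..} then - X i \<omega> else X i \<omega>) i" for i
      have 1: "(\<Sum>i<k. Y i) = S k \<omega>" if "k \<le> j" for k
        unfolding S_def using that j by (intro sum.cong) (auto simp: Y_def)
      have split: "{..<N} = {..<j} \<union> {j..<N}" using j by auto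
      have "(\<Sum>i<N. Y i) = (\<Sum>i<j. Y i) + (\<Sum>i=j..<N. Y i)"
        unfolding split by (rule sum.union_disjoint) auto
      also have "(\<Sum>i=j..<N. Y i) = - (\<Sum>i=j..<N. X i \<omega>)"
        unfolding sum_negf[symmetric] by (intro sum.cong) (auto simp: Y_def)
      also have "(\<Sum>i=j..<N. X i \<omega>) = S N \<omega> - S j \<omega>"
      proof -
        have "S N \<omega> = S j \<omega> + (\<Sum>i=j..<N. X i \<omega>)"
          unfolding S_def split by (rule sum.union_disjoint) auto
        then show ?thesis by simp
      qed
      finally have 2: "(\<Sum>i<N. Y i) = 2 * S j \<omega> - S N \<omega>" using 1[of j] by simp
      have "(\<lambda>i\<in>{..<N}. if i \<in> {j..} then - X i \<omega> else X i \<omega>) \<in> C \<longleftrightarrow>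
         a < (\<Sum>i<j. Y i) \<and> (\<forall>k\<in>{..<j}. (\<Sum>i<k. Y i) \<le> a) \<and> (\<Sum>i<N. Y i) \<le> a"
        unfolding C_def Y_def by (simp add: space_PiM)
      also have "\<dots> \<longleftrightarrow> P j \<omega> \<and> 2 * S j \<omega> - S N \<omega> \<le> a"
        using 1 2 by (auto simp: P_def)
      finally show ?thesis .
    qed
    have id: "(\<lambda>i\<in>{..<N}. X i \<omega>) \<in> C \<longleftrightarrow> P j \<omega> \<and> S N \<omega> \<le> a" for \<omega>
    proof -
      have 1: "(\<Sum>i<k. (\<lambda>i\<in>{..<N}. X i \<omega>) i) = S k \<omega>" if "k \<le> N" for k
        unfolding S_def using that by (intro sum.cong) auto
      show ?thesis unfolding C_def mem_Collect_eq using 1 j by (auto simp: P_def space_PiM)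
    qed
    have "{..<N} \<noteq> {}" using N by blast
    then show ?thesis
      using prob_sign_flip[OF ind _ _ C, of "{j..}"] sym unfolding flip id by simp
  qed
  \<comment> \<open>The passage index is unique, so both events split disjointly over its values and
    the identity for fixed \<open>j\<close> can be summed.\<close>
  have "\<P>(\<omega> in M. (\<exists>i\<le>N. a < S i \<omega>) \<and> S N \<omega> \<le> a)
      = prob (\<Union>j\<in>{..N}. {\<omega>\<in>space M. P j \<omega> \<and> S N \<omega> \<le> a})"
    unfolding ex by (intro arg_cong[where f=prob]) auto
  also have "\<dots> = (\<Sum>j\<in>{..N}. \<P>(\<omega> in M. P j \<omega> \<and> S N \<omega> \<le> a))"
    by (intro finite_measure_finite_Union disj) auto
  also have "\<dots> = (\<Sum>j\<in>{..N}. \<P>(\<omega> in M. P j \<omega> \<and> 2 * S j \<omega> - S N \<omega> \<le> a))"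
    by (intro sum.cong refl eq) simp
  also have "\<dots> = prob (\<Union>j\<in>{..N}. {\<omega>\<in>space M. P j \<omega> \<and> 2 * S j \<omega> - S N \<omega> \<le> a})"
    by (intro finite_measure_finite_Union[symmetric] disj) auto
  also have "(\<Union>j\<in>{..N}. {\<omega>\<in>space M. P j \<omega> \<and> 2 * S j \<omega> - S N \<omega> \<le> a})
     = {\<omega>\<in>space M. (\<exists>i\<le>N. a < S i \<omega>) \<and> 2 * S (T \<omega>) \<omega> - S N \<omega> \<le> a}"
    unfolding ex using T by auto
  finally show ?thesis .
qed

section \<open>Running maxima as functionals of the path\<close>

text \<open>Only rational times are used, with the condition \<open>q \<le> y\<close> inside the supremum, so that the
  functional is jointly measurable in \<open>y\<close> and the path. Negative values are cut off at \<open>0\<close>, which is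
  harmless for paths starting at \<open>0\<close>.\<close>
definition pathsup :: "real \<Rightarrow> (real \<Rightarrow> real) \<Rightarrow> real" where
  "pathsup y w = enn2real (SUP q\<in>{0..} \<inter> \<rat>. if q \<le> y then ennreal (w q) else 0)"

text \<open>A countable supremum of jointly measurable terms, each reading one coordinate of the
  path. The parameter \<open>\<phi>\<close> covers both the path and its absolute value.\<close>

lemma measurable_pathsup [measurable]:
  assumes [measurable]: "\<phi> \<in> borel_measurable borel"
  shows "(\<lambda>(y, w). pathsup y (\<lambda>z. \<phi> (w z))) \<in> borel_measurable (borel \<Otimes>\<^sub>M (\<Pi>\<^sub>M t\<in>{0::real..}. (borel :: real measure)))"
  unfolding pathsup_def split_beta'
  by (intro borel_measurable_enn2real borel_measurable_SUP countable_Int2 countable_rat) measurable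

lemma pathsup_nonneg: "0 \<le> pathsup y w"
  by (simp add: pathsup_def)

lemma pathsup_0 [simp]: "w 0 = 0 \<Longrightarrow> pathsup 0 w = 0"
  unfolding pathsup_def
  by (subst SUP_eq_const[where x=0]) (auto intro!: exI[of _ 0])

lemma pathsup_cong: "(\<And>q. 0 \<le> q \<Longrightarrow> v q = w q) \<Longrightarrow> pathsup y v = pathsup y w"
  unfolding pathsup_def by (intro arg_cong[where f=enn2real] SUP_cong) auto

text \<open>Rational times are dense and the path is continuous, so they already determine the
  supremum; the value 0 at time 0 makes the cut-off at 0 invisible.\<close>

lemma pathsup_eq_SUP:
  assumes "0 \<le> y" and cont: "continuous_on {0..} w" and w0: "w 0 = 0"
  shows "pathsup y w = (SUP z\<in>{0..y}. w z)"
proof -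
  have bdd: "bdd_above (w ` {0..y})"
    using compact_continuous_image[OF continuous_on_subset[OF cont], of "{0..y}"]
    by (auto intro: bounded_imp_bdd_above compact_imp_bounded)
  let ?s = "SUP z\<in>{0..y}. w z"
  have s0: "0 \<le> ?s"
    using cSUP_upper[OF _ bdd, of 0] \<open>0 \<le> y\<close> w0 by simp
  have "(SUP q\<in>{0..} \<inter> \<rat>. if q \<le> y then ennreal (w q) else 0) = ennreal ?s"
  proof (rule antisym)
    show "(SUP q\<in>{0..} \<inter> \<rat>. if q \<le> y then ennreal (w q) else 0) \<le> ennreal ?s"
      by (intro SUP_least) (auto intro!: ennreal_leI cSUP_upper bdd)
  next
    let ?r = "SUP q\<in>{0..} \<inter> \<rat>. if q \<le> y then ennreal (w q) else 0"
    have rat: "ennreal (w q) \<le> ?r" if "q \<in> \<rat>" "0 \<le> q" "q \<le> y" for q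
      using that by (intro SUP_upper2[of q]) auto
    have all: "ennreal (w z) \<le> ?r" if z: "z \<in> {0..y}" for z
    \<comment> \<open>For \<open>y = 0\<close> there is no room to approximate by rationals, but
      then \<open>z = 0\<close> and the value is 0.\<close>
    proof (cases "0 < y")
      case False
      with z have "z = 0" by simp
      then show ?thesis by (simp add: w0)
    next
      case True
      show ?thesis
      proof (rule ccontr)
        assume "\<not> ennreal (w z) \<le> ?r"
        then have less: "?r < ennreal (w z)" by simp
        have "continuous_on {0..y} w" using cont by (rule continuous_on_subset) auto
        then have "continuous_on {0..y} (\<lambda>z. ennreal (w z))"
          by (intro continuous_on_ennreal)
        then have "((\<lambda>z. ennreal (w z)) \<longlongrightarrow> ennreal (w z)) (at z within {0..y})"
          using z by (auto simp: continuous_on)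
        then have "eventually (\<lambda>x. ?r < ennreal (w x)) (at z within {0..y})"
          using less by (rule order_tendstoD)
        then obtain d where d: "d > 0" "\<And>x. x \<in> {0..y} \<Longrightarrow> x \<noteq> z \<Longrightarrow> dist x z < d \<Longrightarrow> ?r < ennreal (w x)"
          by (auto simp: eventually_at)
        \<comment> \<open>Any rational strictly between these bounds lies in \<open>{0..y}\<close>
          and within \<open>d\<close> of \<open>z\<close>, where the path still exceeds the supposed
          bound.\<close>
        have "max 0 (z - d) < min y (z + d)" using True z d(1) by auto
        then obtain q where q: "q \<in> \<rat>" "max 0 (z - d) < q" "q < min y (z + d)"
          using Rats_dense_in_real by blast
        then have "?r < ennreal (w q)"
          using d(2)[of q] less by (cases "q = z") (auto simp: dist_real_def)
        with rat[of q] q show False by auto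
      qed
    qed
    show "ennreal ?s \<le> ?r"
    proof (cases "?r")
      case (real r)
      have "w z \<le> r" if "z \<in> {0..y}" for z
        using all[OF that] real by (simp add: ennreal_le_iff)
      then have "?s \<le> r" using \<open>0 \<le> y\<close> by (intro cSUP_least) auto
      then show ?thesis using real by (simp add: ennreal_leI)
    next
      case top
      then show ?thesis by (metis top_greatest)
    qed
  qed
  then show ?thesis unfolding pathsup_def using s0 by simp
qed

lemma image_abs_path:
  fixes w :: "real \<Rightarrow> real"
  assumes "0 \<le> y" and cont: "continuous_on {0..} w" and w0: "w 0 = (0::real)"
  shows "(\<lambda>z. \<bar>w z\<bar>) ` {0..y} = {0..SUP z\<in>{0..y}. \<bar>w z\<bar>}"
proof -
  have c: "continuous_on {0..y} (\<lambda>z. \<bar>w z\<bar>)"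
    by (intro continuous_on_rabs continuous_on_subset[OF cont]) auto
  then have comp: "compact ((\<lambda>z. \<bar>w z\<bar>) ` {0..y})" by (intro compact_continuous_image compact_Icc)
  have ne: "(\<lambda>z. \<bar>w z\<bar>) ` {0..y} \<noteq> {}" using \<open>0 \<le> y\<close> by auto
  have mem: "(SUP z\<in>{0..y}. \<bar>w z\<bar>) \<in> (\<lambda>z. \<bar>w z\<bar>) ` {0..y}"
    using comp ne by (intro closed_contains_Sup) (auto intro: bounded_imp_bdd_above compact_imp_bounded compact_imp_closed)
  show ?thesis
  proof (intro equalityI subsetI)
    fix v assume "v \<in> (\<lambda>z. \<bar>w z\<bar>) ` {0..y}"
    then show "v \<in> {0..SUP z\<in>{0..y}. \<bar>w z\<bar>}"
      using comp by (auto intro!: cSUP_upper bounded_imp_bdd_above compact_imp_bounded)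
  next
    fix v assume v: "v \<in> {0..SUP z\<in>{0..y}. \<bar>w z\<bar>}"
    \<comment> \<open>The supremum is attained at \<open>x\<close> by compactness; the intermediate
      value theorem between times 0 and \<open>x\<close> then reaches every smaller level.\<close>
    obtain x where x: "x \<in> {0..y}" "(SUP z\<in>{0..y}. \<bar>w z\<bar>) = \<bar>w x\<bar>" using mem by auto
    have "\<exists>z\<ge>0. z \<le> x \<and> \<bar>w z\<bar> = v"
      using v x w0 by (intro IVT' continuous_on_subset[OF c]) auto
    then show "v \<in> (\<lambda>z. \<bar>w z\<bar>) ` {0..y}" using x by auto
  qed
qed

section \<open>Nested maxima and the range of the iterated process\<close>

text \<open>Involves the motions \<open>B k\<close>, ..., \<open>B (k + m - 1)\<close>, the last one
  innermost on \<open>{0..t}\<close>. The random horizon of the overview is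
  \<open>chainmax B 2 n t\<close>.\<close>

fun chainmax :: "(nat \<Rightarrow> real \<Rightarrow> 'a \<Rightarrow> real) \<Rightarrow> nat \<Rightarrow> nat \<Rightarrow> real \<Rightarrow> 'a \<Rightarrow> real" where
  "chainmax B k 0 t \<omega> = t"
| "chainmax B k (Suc m) t \<omega> = absmax B k (chainmax B (Suc k) m t \<omega>) \<omega>"

lemma chainmax_nonneg:
  assumes "0 \<le> t" "\<And>j. k \<le> j \<Longrightarrow> j < k + m \<Longrightarrow> B j 0 \<omega> = 0 \<and> continuous_on {0..} (\<lambda>t. B j t \<omega>)"
  shows "0 \<le> chainmax B k m t \<omega>"
  using assms
proof (induction m arbitrary: k)
  case (Suc m)
  let ?y = "chainmax B (Suc k) m t \<omega>"
  have "0 \<le> ?y" using Suc.prems by (intro Suc.IH) auto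
  then have "(\<lambda>z. \<bar>B k z \<omega>\<bar>) ` {0..?y} = {0..absmax B k ?y \<omega>}"
    unfolding absmax_def using Suc.prems(2)[of k] by (intro image_abs_path) auto
  \<comment> \<open>An interval starting at 0 is nonempty only if its right end is
    nonnegative.\<close>
  moreover have "(\<lambda>z. \<bar>B k z \<omega>\<bar>) ` {0..?y} \<noteq> {}" using \<open>0 \<le> ?y\<close> by auto
  ultimately show ?case by auto
qed simp

text \<open>Peeling off the outermost motion leaves an inner process whose absolute values fill an
  interval from 0, and that interval is the time set on which the outer path is read.\<close>

lemma image_itbm:
  assumes "0 \<le> t" "\<And>j. k \<le> j \<Longrightarrow> j \<le> k + m \<Longrightarrow> B j 0 \<omega> = 0 \<and> continuous_on {0..} (\<lambda>t. B j t \<omega>)"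
  shows "(\<lambda>s. \<bar>itbm B k m s \<omega>\<bar>) ` {0..t} = {0..chainmax B k (Suc m) t \<omega>}"
  using assms
proof (induction m arbitrary: k)
  case 0
  then show ?case unfolding chainmax.simps absmax_def itbm.simps by (intro image_abs_path) auto
next
  case (Suc m)
  have "(\<lambda>s. \<bar>itbm B k (Suc m) s \<omega>\<bar>) ` {0..t} = (\<lambda>z. \<bar>B k z \<omega>\<bar>) ` (\<lambda>s. \<bar>itbm B (Suc k) m s \<omega>\<bar>) ` {0..t}"
    by (simp add: image_image)
  also have "(\<lambda>s. \<bar>itbm B (Suc k) m s \<omega>\<bar>) ` {0..t} = {0..chainmax B (Suc k) (Suc m) t \<omega>}"
    using Suc.prems by (intro Suc.IH) auto
  also have "(\<lambda>z. \<bar>B k z \<omega>\<bar>) ` \<dots> = {0..chainmax B k (Suc (Suc m)) t \<omega>}"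
    unfolding chainmax.simps(2)[of B k] absmax_def using Suc.prems
    by (intro image_abs_path chainmax_nonneg) auto
  finally show ?case .
qed

text \<open>The outermost motion carries no absolute value, so only its time argument is replaced by
  the interval that the inner process sweeps out.\<close>

lemma SUP_itbm:
  assumes "0 \<le> t" "\<And>j. k \<le> j \<Longrightarrow> j \<le> k + Suc m \<Longrightarrow> B j 0 \<omega> = 0 \<and> continuous_on {0..} (\<lambda>t. B j t \<omega>)"
  shows "(SUP s\<in>{0..t}. itbm B k (Suc m) s \<omega>) = (SUP z\<in>{0..chainmax B (Suc k) (Suc m) t \<omega>}. B k z \<omega>)"
proof -
  have "(\<lambda>s. itbm B k (Suc m) s \<omega>) ` {0..t} = (\<lambda>z. B k z \<omega>) ` (\<lambda>s. \<bar>itbm B (Suc k) m s \<omega>\<bar>) ` {0..t}"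
    by (simp add: image_image)
  also have "(\<lambda>s. \<bar>itbm B (Suc k) m s \<omega>\<bar>) ` {0..t} = {0..chainmax B (Suc k) (Suc m) t \<omega>}"
    using assms by (intro image_itbm) auto
  finally show ?thesis by simp
qed

section \<open>The reflection principle for Brownian motion\<close>

text \<open>Dominated convergence for indicators that are eventually constant at each point; this
  passes from grids to continuous time.\<close>

lemma (in finite_measure) tendsto_measure_eventually_eq:
  assumes [measurable]: "\<And>m. A m \<in> sets M" "C \<in> sets M"
    and ev: "\<And>\<omega>. \<omega> \<in> space M \<Longrightarrow> \<forall>\<^sub>F m in sequentially. \<omega> \<in> A m \<longleftrightarrow> \<omega> \<in> C"
  shows "(\<lambda>m. measure M (A m)) \<longlonglongrightarrow> measure M C"
proof -
  have "(\<lambda>m. \<integral>\<omega>. indicator (A m) \<omega> \<partial>M) \<longlonglongrightarrow> (\<integral>\<omega>. indicator C \<omega> \<partial>M :: real)"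
  proof (rule integral_dominated_convergence[where w="\<lambda>_. 1"])
    show "AE \<omega> in M. (\<lambda>m. indicator (A m) \<omega>) \<longlonglongrightarrow> (indicator C \<omega> :: real)"
    proof (rule AE_I2)
      fix \<omega> assume "\<omega> \<in> space M"
      then show "(\<lambda>m. indicator (A m) \<omega>) \<longlonglongrightarrow> (indicator C \<omega> :: real)"
        by (intro tendsto_eventually eventually_mono[OF ev]) (auto simp: indicator_def)
    qed
  qed (auto simp: indicator_def)
  then show ?thesis by simp
qed

section \<open>Continuous paths on refining grids\<close>

lemma eventually_small_oscillation:
  fixes w :: "real \<Rightarrow> real"
  assumes "continuous_on {0..y} w" "0 < e"
  shows "\<forall>\<^sub>F m in sequentially. \<forall>u\<in>{0..y}. \<forall>v\<in>{0..y}. \<bar>u - v\<bar> \<le> y / real (Suc m) \<longrightarrow> \<bar>w u - w v\<bar> < e"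
proof -
  have "uniformly_continuous_on {0..y} w"
    using assms by (intro compact_uniformly_continuous) auto
  then obtain d where d: "d > 0" "\<And>u v. u \<in> {0..y} \<Longrightarrow> v \<in> {0..y} \<Longrightarrow> dist v u < d \<Longrightarrow> dist (w v) (w u) < e"
    using \<open>0 < e\<close> unfolding uniformly_continuous_on_def by metis
  have "(\<lambda>m. y / real (Suc m)) \<longlonglongrightarrow> 0"
    by (rule LIMSEQ_Suc[OF lim_const_over_n])
  then have "\<forall>\<^sub>F m in sequentially. y / real (Suc m) < d"
    using d(1) by (rule order_tendstoD)
  then show ?thesis
    by eventually_elim (use d(2) in \<open>force simp: dist_real_def\<close>)
qed

lemma grid_point_in_interval:
  fixes y :: real
  assumes "0 \<le> y" "k \<le> Suc m"
  shows "y * real k / real (Suc m) \<in> {0..y}"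
  using assms mult_left_mono[of "real k" "real (Suc m)" y] by (simp add: divide_le_eq)

lemma eventually_grid_exceeds:
  fixes w :: "real \<Rightarrow> real"
  assumes "continuous_on {0..y} w" "0 < y" "z \<in> {0..y}" "a < w z"
  shows "\<forall>\<^sub>F m in sequentially. \<exists>i\<le>Suc m. a < w (y * real i / real (Suc m))"
proof -
  have "\<forall>\<^sub>F m in sequentially. \<forall>u\<in>{0..y}. \<forall>v\<in>{0..y}. \<bar>u - v\<bar> \<le> y / real (Suc m) \<longrightarrow> \<bar>w u - w v\<bar> < w z - a"
    using assms by (intro eventually_small_oscillation) auto
  then show ?thesis
  proof eventually_elim
    case (elim m)
    \<comment> \<open>Index of the last grid point at or before \<open>z\<close>; it is less than
      one mesh width away.\<close>
    define i where "i = nat \<lfloor>z * real (Suc m) / y\<rfloor>"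
    have "0 \<le> z * real (Suc m) / y" using assms by auto
    then have i: "real i \<le> z * real (Suc m) / y" "z * real (Suc m) / y < real i + 1"
      unfolding i_def by linarith+
    have le: "y * real i / real (Suc m) \<le> z"
      using i(1) \<open>0 < y\<close> by (simp add: field_simps)
    have ge: "z < y * (real i + 1) / real (Suc m)"
      using i(2) \<open>0 < y\<close> by (simp add: field_simps)
    have "z * real (Suc m) / y \<le> real (Suc m)"
      using assms mult_right_mono[of z y "real (Suc m)"] by (simp add: divide_le_eq mult.commute)
    with i(1) have "real i \<le> real (Suc m)" by linarith
    then have "i \<le> Suc m" by linarith
    have "y * (real i + 1) / real (Suc m) = y * real i / real (Suc m) + y / real (Suc m)"
      by (simp only: distrib_left mult_1_right add_divide_distrib)
    with le ge have "\<bar>z - y * real i / real (Suc m)\<bar> \<le> y / real (Suc m)" by linarith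
    moreover have "y * real i / real (Suc m) \<in> {0..y}" using le assms by auto
    ultimately have "\<bar>w z - w (y * real i / real (Suc m))\<bar> < w z - a"
      using elim assms(3) by blast
    with \<open>i \<le> Suc m\<close> show ?case by (intro exI[of _ i]) linarith
  qed
qed

text \<open>The grid value just before the passage is at most \<open>a\<close>, so the passage value
  lies below the midpoint of \<open>a\<close> and \<open>w y\<close> once the oscillation per mesh
  is under \<open>(w y - a) / 2\<close>; reflecting at it sends the endpoint below
  \<open>a\<close>.\<close>

lemma eventually_small_overshoot:
  fixes w :: "real \<Rightarrow> real"
  assumes "continuous_on {0..y} w" "0 < y" "w 0 = 0" "0 \<le> a" "a < w y"
  shows "\<forall>\<^sub>F m in sequentially.
    2 * w (y * real (LEAST i. a < w (y * real i / real (Suc m))) / real (Suc m)) - w y \<le> a"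
proof -
  have "\<forall>\<^sub>F m in sequentially. \<forall>u\<in>{0..y}. \<forall>v\<in>{0..y}. \<bar>u - v\<bar> \<le> y / real (Suc m) \<longrightarrow> \<bar>w u - w v\<bar> < (w y - a) / 2"
    using assms by (intro eventually_small_oscillation) auto
  then show ?thesis
  proof eventually_elim
    case (elim m)
    let ?P = "\<lambda>i. a < w (y * real i / real (Suc m))"
    let ?t = "\<lambda>i. y * real i / real (Suc m)"
    have last: "?P (Suc m)" using assms by simp
    \<comment> \<open>Since \<open>w 0 = 0 \<le> a\<close>, the passage is not at index 0 and a
      preceding grid point exists.\<close>
    have "(LEAST i. ?P i) \<noteq> 0"
    proof
      assume "(LEAST i. ?P i) = 0"
      with LeastI[of ?P, OF last] have "a < w 0" by simp
      with assms show False by simp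
    qed
    then obtain j where j: "(LEAST i. ?P i) = Suc j" by (cases "LEAST i. ?P i") auto
    have "Suc j \<le> Suc m" using Least_le[of ?P, OF last] j by simp
    have mem: "?t k \<in> {0..y}" if "k \<le> Suc m" for k
      using that \<open>0 < y\<close> by (intro grid_point_in_interval) auto
    have "\<not> ?P j" using j by (intro not_less_Least) simp
    moreover have "?t (Suc j) - ?t j = y / real (Suc m)"
      unfolding of_nat_Suc[of j] by (simp add: add_divide_distrib distrib_left del: of_nat_Suc)
    then have "\<bar>?t (Suc j) - ?t j\<bar> \<le> y / real (Suc m)"
      using \<open>0 < y\<close> by simp
    then have "\<bar>w (?t (Suc j)) - w (?t j)\<bar> < (w y - a) / 2"
      using elim mem[of "Suc j"] mem[of j] \<open>Suc j \<le> Suc m\<close> by auto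
    moreover have "2 * u - c \<le> a" if "\<not> a < v" "\<bar>u - v\<bar> < (c - a) / 2" for u v c :: real
      using order.strict_trans1[OF abs_ge_self that(2)] that(1) by (simp add: field_simps)
    ultimately have "2 * w (?t (Suc j)) - w y \<le> a" by blast
    then show ?case unfolding j .
  qed
qed

lemma brownian_increment_symmetric:
  assumes "std_brownian_motion M B" "0 \<le> s" "s < t"
  shows "distr M borel (\<lambda>\<omega>. - (B t \<omega> - B s \<omega>)) = distr M borel (\<lambda>\<omega>. B t \<omega> - B s \<omega>)"
proof -
  interpret prob_space M using assms by (simp add: std_brownian_motion_def)
  let ?f = "normal_density 0 (sqrt (t - s))"
  have d: "distributed M lborel (\<lambda>\<omega>. B t \<omega> - B s \<omega>) ?f"
    using assms by (simp add: std_brownian_motion_def)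
  have "distributed M lborel (\<lambda>\<omega>. 0 + (-1) * (B t \<omega> - B s \<omega>)) (normal_density (0 + (-1) * 0) (\<bar>-1\<bar> * sqrt (t - s)))"
    using assms by (intro normal_density_affine d) auto
  then have d': "distributed M lborel (\<lambda>\<omega>. - (B t \<omega> - B s \<omega>)) ?f" by simp
  \<comment> \<open>Densities are stated over \<open>lborel\<close>, independence over
    \<open>borel\<close>; the two have the same measurable sets.\<close>
  have "distr M borel (\<lambda>\<omega>. - (B t \<omega> - B s \<omega>)) = distr M lborel (\<lambda>\<omega>. - (B t \<omega> - B s \<omega>))"
    by (intro distr_cong) auto
  also have "\<dots> = distr M lborel (\<lambda>\<omega>. B t \<omega> - B s \<omega>)"
    using distributed_distr_eq_density[OF d] distributed_distr_eq_density[OF d'] by simp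
  also have "\<dots> = distr M borel (\<lambda>\<omega>. B t \<omega> - B s \<omega>)"
    by (intro distr_cong) auto
  finally show ?thesis .
qed

section \<open>Brownian paths and their running maxima\<close>

lemma std_brownian_motionD:
  assumes "std_brownian_motion M B"
  shows "prob_space M" "\<And>t. 0 \<le> t \<Longrightarrow> B t \<in> borel_measurable M"
    "\<And>\<omega>. \<omega> \<in> space M \<Longrightarrow> B 0 \<omega> = 0" "\<And>\<omega>. \<omega> \<in> space M \<Longrightarrow> continuous_on {0..} (\<lambda>t. B t \<omega>)"
  using assms by (auto simp: std_brownian_motion_def)

lemma brownian_pathsup_eq:
  assumes "std_brownian_motion M B" "\<omega> \<in> space M" "0 \<le> y"
  shows "pathsup y (\<lambda>t. B t \<omega>) = (SUP z\<in>{0..y}. B z \<omega>)"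
    and "pathsup y (\<lambda>t. \<bar>B t \<omega>\<bar>) = (SUP z\<in>{0..y}. \<bar>B z \<omega>\<bar>)"
  using std_brownian_motionD[OF assms(1)] assms(2,3)
  by (auto intro!: pathsup_eq_SUP continuous_on_rabs)

lemma brownian_exceeds_iff:
  assumes "std_brownian_motion M B" "\<omega> \<in> space M" "0 \<le> y"
  shows "a < pathsup y (\<lambda>t. B t \<omega>) \<longleftrightarrow> (\<exists>z\<in>{0..y}. a < B z \<omega>)"
proof -
  have "continuous_on {0..y} (\<lambda>t. B t \<omega>)"
    using std_brownian_motionD(4)[OF assms(1,2)] by (rule continuous_on_subset) auto
  then have "bdd_above ((\<lambda>z. B z \<omega>) ` {0..y})"
    by (intro bounded_imp_bdd_above compact_imp_bounded compact_continuous_image) auto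
  then show ?thesis
    unfolding brownian_pathsup_eq(1)[OF assms] using \<open>0 \<le> y\<close> by (intro less_cSUP_iff) auto
qed

lemma measurable_brownian_path:
  assumes "std_brownian_motion M B"
  shows "(\<lambda>\<omega>. \<lambda>t\<in>{0..}. B t \<omega>) \<in> measurable M (\<Pi>\<^sub>M t\<in>{0::real..}. (borel :: real measure))"
  using std_brownian_motionD(2)[OF assms] by (intro measurable_restrict) auto

lemma measurable_pathsup_fixed:
  assumes "\<phi> \<in> borel_measurable borel"
  shows "(\<lambda>w. pathsup y (\<lambda>z. \<phi> (w z))) \<in> borel_measurable (\<Pi>\<^sub>M t\<in>{0::real..}. (borel :: real measure))"
  using measurable_compose[OF measurable_Pair1' measurable_pathsup[OF assms], of y] by simp

lemma measurable_brownian_pathsup: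
  assumes "std_brownian_motion M B" "\<phi> \<in> borel_measurable borel"
  shows "(\<lambda>\<omega>. pathsup y (\<lambda>t. \<phi> (B t \<omega>))) \<in> borel_measurable M"
proof -
  have "pathsup y (\<lambda>t. \<phi> ((\<lambda>t\<in>{0..}. B t \<omega>) t)) = pathsup y (\<lambda>t. \<phi> (B t \<omega>))" for \<omega>
    by (rule pathsup_cong) simp
  then show ?thesis
    using measurable_compose[OF measurable_brownian_path[OF assms(1)] measurable_pathsup_fixed[OF assms(2)], of y] by simp
qed

text \<open>Exceeding \<open>a\<close> on the grid splits according to whether
  \<open>a < B y\<close>; the part with \<open>B y \<le> a\<close> has the probability of its
  reflected event \<open>E m\<close>. Under refinement \<open>G m\<close> tends to exceeding
  \<open>a\<close> at some time and \<open>E m\<close> to \<open>a < B y\<close>, whence the factor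
  2.\<close>

lemma reflection_principle_tail:
  assumes bm: "std_brownian_motion M B" and y: "0 < y" and a: "0 \<le> a"
  shows "\<P>(\<omega> in M. a < pathsup y (\<lambda>t. B t \<omega>)) = 2 * \<P>(\<omega> in M. a < B y \<omega>)"
proof -
  interpret prob_space M using std_brownian_motionD(1)[OF bm] .
  note rv [measurable] = std_brownian_motionD(2)[OF bm]
  have cont: "continuous_on {0..y} (\<lambda>t. B t \<omega>)" if "\<omega> \<in> space M" for \<omega>
    using std_brownian_motionD(4)[OF bm that] by (rule continuous_on_subset) auto
  define ts where "ts m i = y * real i / real (Suc m)" for m i
  have ts: "ts m i \<ge> 0" "ts m 0 = 0" "ts m (Suc m) = y" for m i
    using y by (auto simp: ts_def)
  \<comment> \<open>Brownian increments are independent along sequences increasing on all naturals,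
    so the grid formula continues past the endpoint index \<open>Suc m\<close>.\<close>
  have mono: "strict_mono (ts m)" for m
    unfolding strict_mono_def ts_def using y by (auto intro!: divide_strict_right_mono)
  define T where "T m \<omega> = (LEAST i. a < B (ts m i) \<omega>)" for m \<omega>
  define G where "G m = {\<omega>\<in>space M. \<exists>i\<le>Suc m. a < B (ts m i) \<omega>}" for m
  define E where "E m = {\<omega>\<in>space M. (\<exists>i\<le>Suc m. a < B (ts m i) \<omega>) \<and> 2 * B (ts m (T m \<omega>)) \<omega> - B y \<omega> \<le> a}" for m
  have [measurable]: "B (ts m i) \<in> borel_measurable M" for m i
    using ts by (intro rv)
  have [measurable]: "B y \<in> borel_measurable M" using y by (intro rv) simp
  have [measurable]: "T m \<in> measurable M (count_space UNIV)" for m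
    unfolding T_def [abs_def] by measurable
  \<comment> \<open>The random index takes countably many values, so measurability is checked on
    each of them.\<close>
  have [measurable]: "(\<lambda>\<omega>. B (ts m (T m \<omega>)) \<omega>) \<in> borel_measurable M" for m
    by (rule measurable_compose_countable[where g="T m"]) auto
  have [measurable]: "G m \<in> sets M" "E m \<in> sets M" for m
    unfolding G_def E_def by measurable
  have T: "a < B (ts m (T m \<omega>)) \<omega>" if "\<exists>i\<le>Suc m. a < B (ts m i) \<omega>" for m \<omega>
    unfolding T_def using that by (auto intro: LeastI)

  have refl: "prob (G m) = \<P>(\<omega> in M. a < B y \<omega>) + prob (E m)" for m
  proof -
    have ind: "indep_vars (\<lambda>_. borel) (\<lambda>i \<omega>. B (ts m (Suc i)) \<omega> - B (ts m i) \<omega>) {..<Suc m}"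
      using bm ts(1) mono unfolding std_brownian_motion_def by blast
    \<comment> \<open>Puts the random walk of increments in terms of the motion; the subtracted
      value at time 0 vanishes on the sample space.\<close>
    have telescope: "(\<Sum>i<k. B (ts m (Suc i)) \<omega> - B (ts m i) \<omega>) = B (ts m k) \<omega> - B (ts m 0) \<omega>" for k \<omega>
      by (rule sum_lessThan_telescope)
    have "\<P>(\<omega> in M. (\<exists>i\<le>Suc m. a < B (ts m i) \<omega> - B (ts m 0) \<omega>) \<and> B (ts m (Suc m)) \<omega> - B (ts m 0) \<omega> \<le> a)
        = \<P>(\<omega> in M. (\<exists>i\<le>Suc m. a < B (ts m i) \<omega> - B (ts m 0) \<omega>) \<and>
            2 * (B (ts m (LEAST i. a < B (ts m i) \<omega> - B (ts m 0) \<omega>)) \<omega> - B (ts m 0) \<omega>)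
              - (B (ts m (Suc m)) \<omega> - B (ts m 0) \<omega>) \<le> a)"
      by (rule discrete_reflection[OF ind zero_less_Suc, of a, unfolded telescope],
          rule brownian_increment_symmetric[OF bm ts(1)]) (use mono in \<open>simp add: strict_mono_def\<close>)
    also have "{\<omega>\<in>space M. (\<exists>i\<le>Suc m. a < B (ts m i) \<omega> - B (ts m 0) \<omega>) \<and>
            2 * (B (ts m (LEAST i. a < B (ts m i) \<omega> - B (ts m 0) \<omega>)) \<omega> - B (ts m 0) \<omega>)
              - (B (ts m (Suc m)) \<omega> - B (ts m 0) \<omega>) \<le> a} = E m"
      unfolding E_def T_def ts(2,3) using std_brownian_motionD(3)[OF bm] by (intro Collect_cong conj_cong refl) auto
    also have "{\<omega>\<in>space M. (\<exists>i\<le>Suc m. a < B (ts m i) \<omega> - B (ts m 0) \<omega>) \<and> B (ts m (Suc m)) \<omega> - B (ts m 0) \<omega> \<le> a}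
       = {\<omega>\<in>space M. (\<exists>i\<le>Suc m. a < B (ts m i) \<omega>) \<and> B y \<omega> \<le> a}"
      unfolding ts(2,3) using std_brownian_motionD(3)[OF bm] by (intro Collect_cong conj_cong refl) auto
    finally have E: "\<P>(\<omega> in M. (\<exists>i\<le>Suc m. a < B (ts m i) \<omega>) \<and> B y \<omega> \<le> a) = prob (E m)" .
    have "G m = {\<omega>\<in>space M. a < B y \<omega>} \<union> {\<omega>\<in>space M. (\<exists>i\<le>Suc m. a < B (ts m i) \<omega>) \<and> B y \<omega> \<le> a}"
      unfolding G_def using ts(3)[of m] by (auto simp: not_less[symmetric] intro: exI[of _ "Suc m"])
    also have "prob \<dots> = \<P>(\<omega> in M. a < B y \<omega>) + \<P>(\<omega> in M. (\<exists>i\<le>Suc m. a < B (ts m i) \<omega>) \<and> B y \<omega> \<le> a)"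
      by (rule finite_measure_Union) auto
    finally show ?thesis using E by simp
  qed

  have "(\<lambda>m. prob (G m)) \<longlonglongrightarrow> \<P>(\<omega> in M. a < pathsup y (\<lambda>t. B t \<omega>))"
  proof (rule tendsto_measure_eventually_eq)
    show "{\<omega>\<in>space M. a < pathsup y (\<lambda>t. B t \<omega>)} \<in> sets M"
      using measurable_brownian_pathsup[OF bm, of "\<lambda>x. x" y] by measurable
    fix \<omega> assume \<omega>: "\<omega> \<in> space M"
    have iff: "a < pathsup y (\<lambda>t. B t \<omega>) \<longleftrightarrow> (\<exists>z\<in>{0..y}. a < B z \<omega>)"
      using brownian_exceeds_iff[OF bm \<omega>] y by simp
    show "\<forall>\<^sub>F m in sequentially. \<omega> \<in> G m \<longleftrightarrow> \<omega> \<in> {\<omega>\<in>space M. a < pathsup y (\<lambda>t. B t \<omega>)}"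
    proof (cases "\<exists>z\<in>{0..y}. a < B z \<omega>")
      case True
      then obtain z where z: "z \<in> {0..y}" "a < B z \<omega>" by blast
      from eventually_grid_exceeds[OF cont[OF \<omega>] y z] show ?thesis
        by eventually_elim (use True \<omega> iff in \<open>auto simp: G_def ts_def\<close>)
    next
      case False
      moreover have "ts m i \<in> {0..y}" if "i \<le> Suc m" for m i
        using that y unfolding ts_def by (intro grid_point_in_interval) auto
      ultimately have "\<omega> \<notin> G m" for m unfolding G_def by blast
      then show ?thesis using False iff by (intro always_eventually) auto
    qed
  qed auto
  moreover have "(\<lambda>m. prob (E m)) \<longlonglongrightarrow> \<P>(\<omega> in M. a < B y \<omega>)"
  proof (rule tendsto_measure_eventually_eq)
    fix \<omega> assume \<omega>: "\<omega> \<in> space M"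
    show "\<forall>\<^sub>F m in sequentially. \<omega> \<in> E m \<longleftrightarrow> \<omega> \<in> {\<omega>\<in>space M. a < B y \<omega>}"
    proof (cases "a < B y \<omega>")
      case True
      from eventually_small_overshoot[OF cont[OF \<omega>] y _ a True] std_brownian_motionD(3)[OF bm \<omega>]
      have "\<forall>\<^sub>F m in sequentially. 2 * B (ts m (T m \<omega>)) \<omega> - B y \<omega> \<le> a"
        by (simp add: ts_def T_def)
      then show ?thesis
      proof eventually_elim
        case (elim m)
        have "\<exists>i\<le>Suc m. a < B (ts m i) \<omega>" using True ts(3)[of m] by (intro exI[of _ "Suc m"]) simp
        then show ?case using elim \<omega> True by (simp add: E_def)
      qed
    next
      case False
      \<comment> \<open>With passage value above \<open>a\<close>, a reflected endpoint at most
        \<open>a\<close> would force \<open>B y\<close> above \<open>a\<close>.\<close>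
      have "\<omega> \<notin> E m" for m
      proof
        assume "\<omega> \<in> E m"
        then have "2 * B (ts m (T m \<omega>)) \<omega> - B y \<omega> \<le> a" "a < B (ts m (T m \<omega>)) \<omega>"
          using T by (auto simp: E_def)
        with False show False by linarith
      qed
      then show ?thesis using False by (intro always_eventually) auto
    qed
  qed auto
  then have "(\<lambda>m. prob (G m)) \<longlonglongrightarrow> \<P>(\<omega> in M. a < B y \<omega>) + \<P>(\<omega> in M. a < B y \<omega>)"
    unfolding refl by (intro tendsto_add tendsto_const)
  ultimately show ?thesis
    using LIMSEQ_unique by fastforce
qed

text \<open>Rays generate the Borel sets and are closed under intersection, so tails determine a
  law. The tail identity is available at nonnegative levels, so both laws are first cut down to the
  positive half-line.\<close>

lemma reflection_principle:
  assumes bm: "std_brownian_motion M B" and y: "0 \<le> y" and A: "A \<in> sets borel" "A \<subseteq> {0<..}"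
  shows "\<P>(\<omega> in M. pathsup y (\<lambda>t. B t \<omega>) \<in> A) = 2 * \<P>(\<omega> in M. B y \<omega> \<in> A)"
\<comment> \<open>At time 0 both variables vanish while \<open>A\<close> holds only positive
  numbers, so both events are empty.\<close>
proof (cases "y = 0")
  case True
  have "{\<omega>\<in>space M. pathsup y (\<lambda>t. B t \<omega>) \<in> A} = {}" "{\<omega>\<in>space M. B y \<omega> \<in> A} = {}"
    using std_brownian_motionD(3)[OF bm] A(2) True by auto
  then show ?thesis by (simp only: measure_empty)
next
  case False
  with y have y: "0 < y" by simp
  interpret prob_space M using std_brownian_motionD(1)[OF bm] .
  have m [measurable]: "(\<lambda>\<omega>. pathsup y (\<lambda>t. B t \<omega>)) \<in> borel_measurable M" "B y \<in> borel_measurable M"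
    using measurable_brownian_pathsup[OF bm, of "\<lambda>x. x" y] std_brownian_motionD(2)[OF bm, of y] y by auto
  define \<mu> where "\<mu> = density (distr M borel (\<lambda>\<omega>. pathsup y (\<lambda>t. B t \<omega>))) (indicator {0<..})"
  define \<nu> where "\<nu> = density (distr M borel (B y)) (\<lambda>x. 2 * indicator {0<..} x)"
  have vimage_eq: "f -` D \<inter> space M = {\<omega>\<in>space M. f \<omega> \<in> D}" for f :: "_ \<Rightarrow> real" and D
    by auto
  have \<mu>: "emeasure \<mu> C = ennreal (\<P>(\<omega> in M. pathsup y (\<lambda>t. B t \<omega>) \<in> {0<..} \<inter> C))" if C: "C \<in> sets borel" for C
  proof -
    have "emeasure \<mu> C = emeasure (distr M borel (\<lambda>\<omega>. pathsup y (\<lambda>t. B t \<omega>))) ({0<..} \<inter> C)"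
      unfolding \<mu>_def using C by (subst emeasure_density) (simp_all add: indicator_inter_arith[symmetric])
    also have "\<dots> = ennreal (\<P>(\<omega> in M. pathsup y (\<lambda>t. B t \<omega>) \<in> {0<..} \<inter> C))"
      using C vimage_eq[of "\<lambda>\<omega>. pathsup y (\<lambda>t. B t \<omega>)"]
      by (simp add: emeasure_distr emeasure_eq_measure del: Int_iff greaterThan_iff vimage_Int)
    finally show ?thesis .
  qed
  have \<nu>: "emeasure \<nu> C = ennreal (2 * \<P>(\<omega> in M. B y \<omega> \<in> {0<..} \<inter> C))" if C: "C \<in> sets borel" for C
  proof -
    have "emeasure \<nu> C = 2 * emeasure (distr M borel (B y)) ({0<..} \<inter> C)"
      unfolding \<nu>_def using C
      by (subst emeasure_density) (simp_all add: indicator_inter_arith[symmetric] mult.assoc nn_integral_cmult)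
    also have "\<dots> = ennreal (2 * \<P>(\<omega> in M. B y \<omega> \<in> {0<..} \<inter> C))"
      using C vimage_eq[of "B y"]
      by (simp add: emeasure_distr emeasure_eq_measure ennreal_mult del: Int_iff greaterThan_iff vimage_Int)
    finally show ?thesis .
  qed
  have "\<mu> = \<nu>"
  proof (rule measure_eqI_generator_eq[where \<Omega>=UNIV and E="range (\<lambda>a::real. {a<..})" and A="\<lambda>i. {- real i<..}"])
    show "Int_stable (range (\<lambda>a::real. {a<..}))"
    proof (clarsimp simp: Int_stable_def)
      fix a b :: real
      have "{a<..} \<inter> {b<..} = {max a b<..}" by auto
      then show "{a<..} \<inter> {b<..} \<in> range greaterThan" by simp
    qed
    show "sets \<mu> = sigma_sets UNIV (range greaterThan)" "sets \<nu> = sigma_sets UNIV (range greaterThan)"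
      by (simp_all add: \<mu>_def \<nu>_def borel_Ioi)
    show "(\<Union>i. {- real i<..}) = UNIV"
      by (auto intro: reals_Archimedean2 simp: minus_less_iff)
    show "emeasure \<mu> {- real i<..} \<noteq> \<infinity>" for i
      by (simp add: \<mu>)
    fix C :: "real set" assume "C \<in> range greaterThan"
    then obtain a where C: "C = {a<..}" by auto
    \<comment> \<open>After the cut every ray starts at a nonnegative level, where the tail identity
      applies.\<close>
    have "{0<..} \<inter> C = {max 0 a<..}" by (auto simp: C)
    then show "emeasure \<mu> C = emeasure \<nu> C"
      using reflection_principle_tail[OF bm y, of "max 0 a"] by (simp add: \<mu> \<nu> C)
  qed auto
  then have "ennreal (\<P>(\<omega> in M. pathsup y (\<lambda>t. B t \<omega>) \<in> {0<..} \<inter> A)) = ennreal (2 * \<P>(\<omega> in M. B y \<omega> \<in> {0<..} \<inter> A))"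
    using \<mu>[OF A(1)] \<nu>[OF A(1)] by simp
  moreover have "{0<..} \<inter> A = A" using A(2) by auto
  ultimately show ?thesis by simp
qed

section \<open>Composition of the maxima\<close>

text \<open>The joint law is a product, so Fubini applies to the bounded integrand; both marginals
  are then pulled back to \<open>M\<close>, with \<open>\<omega>'\<close> acting as an independent
  copy.\<close>

lemma (in prob_space) expectation_indep_var:
  fixes f :: "'b \<Rightarrow> 'b \<Rightarrow> real"
  assumes ind: "indep_var S X T Y"
    and f: "case_prod f \<in> borel_measurable (S \<Otimes>\<^sub>M T)" and bound: "\<And>x y. \<bar>f x y\<bar> \<le> C"
  shows "expectation (\<lambda>\<omega>. f (X \<omega>) (Y \<omega>)) = expectation (\<lambda>\<omega>. expectation (\<lambda>\<omega>'. f (X \<omega>) (Y \<omega>')))"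
proof -
  have X [measurable]: "random_variable S X" and Y [measurable]: "random_variable T Y"
    and eq: "distr M S X \<Otimes>\<^sub>M distr M T Y = distr M (S \<Otimes>\<^sub>M T) (\<lambda>x. (X x, Y x))"
    using ind by (simp_all add: indep_var_distribution_eq)
  interpret X: prob_space "distr M S X" by (rule prob_space_distr) fact
  interpret Y: prob_space "distr M T Y" by (rule prob_space_distr) fact
  interpret P: pair_prob_space "distr M S X" "distr M T Y" ..
  have f' [measurable]: "case_prod f \<in> borel_measurable (distr M S X \<Otimes>\<^sub>M distr M T Y)"
    using f by (simp cong: measurable_cong_sets)
  have int: "integrable (distr M S X \<Otimes>\<^sub>M distr M T Y) (case_prod f)"
    by (rule P.integrable_const_bound[where B=C]) (use bound f' in auto)
  have "expectation (\<lambda>\<omega>. f (X \<omega>) (Y \<omega>)) = integral\<^sup>L (distr M (S \<Otimes>\<^sub>M T) (\<lambda>x. (X x, Y x))) (case_prod f)"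
    using f by (subst integral_distr) auto
  also have "\<dots> = (\<integral>x. (\<integral>y. f x y \<partial>distr M T Y) \<partial>distr M S X)"
    unfolding eq[symmetric] by (rule P.integral_fst[symmetric]) (rule int)
  also have "\<dots> = (\<integral>\<omega>. (\<integral>y. f (X \<omega>) y \<partial>distr M T Y) \<partial>M)"
  proof (rule integral_distr[OF X])
    have "(\<lambda>x. \<integral>y. f x y \<partial>distr M T Y) \<in> borel_measurable (distr M S X)"
      by (rule Y.borel_measurable_lebesgue_integral) (use f' in simp)
    then show "(\<lambda>x. \<integral>y. f x y \<partial>distr M T Y) \<in> borel_measurable S" by simp
  qed
  also have "\<dots> = expectation (\<lambda>\<omega>. expectation (\<lambda>\<omega>'. f (X \<omega>) (Y \<omega>')))"
  proof (intro Bochner_Integration.integral_cong refl integral_distr[OF Y])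
    fix \<omega> assume "\<omega> \<in> space M"
    then have "X \<omega> \<in> space S" using X by (rule measurable_space[rotated])
    then show "f (X \<omega>) \<in> borel_measurable T"
      using measurable_compose[OF measurable_Pair1' f] by simp
  qed
  finally show ?thesis .
qed

section \<open>Nested maxima as measurable functionals and their kernels\<close>

text \<open>Counterpart of \<open>chainmax\<close> on deterministic paths, built on
  \<open>pathsup\<close> so that it is measurable on the product path space, where independence is
  formulated.\<close>

fun pathchain :: "(nat \<Rightarrow> real \<Rightarrow> real) \<Rightarrow> nat \<Rightarrow> nat \<Rightarrow> real \<Rightarrow> real" where
  "pathchain w k 0 t = t"
| "pathchain w k (Suc m) t = pathsup (pathchain w (Suc k) m t) (\<lambda>z. \<bar>w k z\<bar>)"

lemma measurable_pathchain:
  assumes "{k..<k + m} \<subseteq> J"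
  shows "(\<lambda>w. pathchain w k m t) \<in> borel_measurable (\<Pi>\<^sub>M j\<in>J. \<Pi>\<^sub>M t\<in>{0::real..}. (borel :: real measure))"
  using assms
proof (induction m arbitrary: k)
  case (Suc m)
  have 1: "(\<lambda>w. pathchain w (Suc k) m t) \<in> borel_measurable (\<Pi>\<^sub>M j\<in>J. \<Pi>\<^sub>M t\<in>{0::real..}. (borel :: real measure))"
    using Suc.prems by (intro Suc.IH) auto
  have 2: "(\<lambda>w. w k) \<in> measurable (\<Pi>\<^sub>M j\<in>J. \<Pi>\<^sub>M t\<in>{0::real..}. (borel :: real measure)) (\<Pi>\<^sub>M t\<in>{0::real..}. (borel :: real measure))"
    using Suc.prems by (intro measurable_component_singleton) auto
  have "(\<lambda>(y, w). pathsup y (\<lambda>z. \<bar>w z\<bar>)) \<in> borel_measurable (borel \<Otimes>\<^sub>M (\<Pi>\<^sub>M t\<in>{0::real..}. (borel :: real measure)))"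
    by (rule measurable_pathsup) simp
  from measurable_compose[OF measurable_Pair[OF 1 2] this] show ?case by simp
qed simp

lemma pathchain_cong:
  assumes "\<And>j z. k \<le> j \<Longrightarrow> j < k + m \<Longrightarrow> 0 \<le> z \<Longrightarrow> v j z = w j z"
  shows "pathchain v k m t = pathchain w k m t"
  using assms
proof (induction m arbitrary: k)
  case (Suc m)
  have "pathchain v (Suc k) m t = pathchain w (Suc k) m t"
    using Suc.prems by (intro Suc.IH) auto
  then show ?case using Suc.prems[of k] by (auto intro!: pathsup_cong)
qed simp

lemma chainmax_eq_pathchain:
  assumes "0 \<le> t" "\<And>j. k \<le> j \<Longrightarrow> j < k + m \<Longrightarrow> std_brownian_motion M (B j)" "\<omega> \<in> space M"
  shows "chainmax B k m t \<omega> = pathchain (\<lambda>j z. B j z \<omega>) k m t"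
  using assms
proof (induction m arbitrary: k)
  case (Suc m)
  have "B j 0 \<omega> = 0 \<and> continuous_on {0..} (\<lambda>t. B j t \<omega>)" if "k \<le> j" "j < k + Suc m" for j
    using std_brownian_motionD(3,4)[OF Suc.prems(2)[OF that] Suc.prems(3)] by simp
  then have "0 \<le> chainmax B (Suc k) m t \<omega>"
    using Suc.prems(1) by (intro chainmax_nonneg) auto
  moreover have "chainmax B (Suc k) m t \<omega> = pathchain (\<lambda>j z. B j z \<omega>) (Suc k) m t"
    using Suc.prems by (intro Suc.IH) auto
  ultimately show ?case
    using brownian_pathsup_eq(2)[of M "B k" \<omega> "chainmax B (Suc k) m t \<omega>"] Suc.prems
    by (simp add: absmax_def)
qed simp

text \<open>Twice \<^const>\<open>rhs_kernel\<close> for \<open>y \<ge> 0\<close>, but is measurable in \<open>y\<close> on the whole line,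
  where \<open>B 1 y\<close> is unconstrained for \<open>y < 0\<close>.\<close>
fun path_kernel :: "'a measure \<Rightarrow> (nat \<Rightarrow> real \<Rightarrow> 'a \<Rightarrow> real) \<Rightarrow> real set \<Rightarrow> nat \<Rightarrow> real \<Rightarrow> real" where
  "path_kernel M B A 0 y = 0"
| "path_kernel M B A (Suc 0) y = (\<integral>\<omega>. indicator A (pathsup y (\<lambda>z. B 1 z \<omega>)) \<partial>M)"
| "path_kernel M B A (Suc (Suc k)) y =
     (\<integral>\<omega>. path_kernel M B A (Suc k) (pathsup y (\<lambda>z. \<bar>B (Suc (Suc k)) z \<omega>\<bar>)) \<partial>M)"

lemma borel_measurable_pathsup_integral:
  assumes bm: "std_brownian_motion M B" and \<phi>: "\<phi> \<in> borel_measurable borel"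
    and h: "h \<in> borel_measurable borel"
  shows "(\<lambda>y. \<integral>\<omega>. h (pathsup y (\<lambda>z. \<phi> (B z \<omega>))) \<partial>M :: real) \<in> borel_measurable borel"
proof -
  interpret prob_space M using std_brownian_motionD(1)[OF bm] .
  have "(\<lambda>(y, \<omega>). pathsup y (\<lambda>z. \<phi> ((\<lambda>t\<in>{0..}. B t \<omega>) z))) \<in> borel_measurable (borel \<Otimes>\<^sub>M M)"
  proof -
    have "(\<lambda>p. (fst p, (\<lambda>t\<in>{0..}. B t (snd p)))) \<in> measurable (borel \<Otimes>\<^sub>M M) (borel \<Otimes>\<^sub>M (\<Pi>\<^sub>M t\<in>{0::real..}. (borel :: real measure)))"
      using measurable_compose[OF measurable_snd measurable_brownian_path[OF bm]]
      by (intro measurable_Pair) auto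
    from measurable_compose[OF this measurable_pathsup[OF \<phi>]] show ?thesis by (simp add: split_beta')
  qed
  \<comment> \<open>\<open>pathsup\<close> reads nonnegative times only, so it does not notice the
    restriction of the path.\<close>
  moreover have "pathsup y (\<lambda>z. \<phi> ((\<lambda>t\<in>{0..}. B t \<omega>) z)) = pathsup y (\<lambda>z. \<phi> (B z \<omega>))" for y \<omega>
    by (rule pathsup_cong) simp
  ultimately have "(\<lambda>(y, \<omega>). pathsup y (\<lambda>z. \<phi> (B z \<omega>))) \<in> borel_measurable (borel \<Otimes>\<^sub>M M)"
    by simp
  from measurable_compose[OF this h] show ?thesis
    by (intro borel_measurable_lebesgue_integral) (simp add: split_beta')
qed

lemma path_kernel_measurable:
  assumes "\<And>j. 1 \<le> j \<Longrightarrow> j \<le> k \<Longrightarrow> std_brownian_motion M (B j)" "A \<in> sets borel"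
  shows "path_kernel M B A k \<in> borel_measurable borel"
  using assms
proof (induction k rule: induct_nat_012)
  case 1
  have "std_brownian_motion M (B 1)" using 1 by simp
  from borel_measurable_pathsup_integral[OF this, of "\<lambda>x. x" "indicator A"] assms(2)
  show ?case by simp
next
  case (ge2 k)
  have IH: "path_kernel M B A (Suc k) \<in> borel_measurable borel" using ge2 by simp
  have "std_brownian_motion M (B (Suc (Suc k)))" using ge2.prems by simp
  from borel_measurable_pathsup_integral[OF this _ IH, of abs] show ?case by simp
qed (simp add: measurable_cong[of borel "path_kernel M B A 0" "\<lambda>_. 0"])

text \<open>A non-integrable function has integral 0 by convention, which still respects the bounds;
  hence \<open>path_kernel\<close> is bounded for arbitrary \<open>B\<close> and
  \<open>A\<close>.\<close>

lemma (in prob_space) integral_bounds_01: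
  fixes f :: "'a \<Rightarrow> real"
  assumes "\<And>x. 0 \<le> f x \<and> f x \<le> 1"
  shows "0 \<le> (\<integral>x. f x \<partial>M) \<and> (\<integral>x. f x \<partial>M) \<le> 1"
proof (cases "integrable M f")
  case True
  then show ?thesis using assms by (auto intro!: integral_le_const)
qed (simp add: not_integrable_integral_eq)

lemma path_kernel_bounds:
  assumes "prob_space M"
  shows "0 \<le> path_kernel M B A k y \<and> path_kernel M B A k y \<le> 1"
  using assms
proof (induction M B A k y rule: path_kernel.induct)
  case (2 M B A y)
  interpret prob_space M by fact
  show ?case unfolding path_kernel.simps
    by (rule integral_bounds_01) (auto simp: indicator_def)
next
  case (3 M B A k y)
  interpret prob_space M by fact
  show ?case unfolding path_kernel.simps using 3
    by (intro integral_bounds_01) auto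
qed simp

text \<open>\<open>rhs_kernel\<close> integrates over the open half-line, \<open>path_kernel\<close>
  also over the point 0. Vanishing there reconciles them: paths start at 0 and \<open>A\<close> is
  positive.\<close>

lemma path_kernel_at_0:
  assumes "\<And>j. 1 \<le> j \<Longrightarrow> j \<le> k \<Longrightarrow> std_brownian_motion M (B j)" "A \<subseteq> {0<..}"
  shows "path_kernel M B A k 0 = 0"
proof -
  have sup: "pathsup 0 (\<lambda>z. B j z \<omega>) = 0" "pathsup 0 (\<lambda>z. \<bar>B j z \<omega>\<bar>) = 0"
    if "1 \<le> j" "j \<le> k" "\<omega> \<in> space M" for j \<omega>
    using std_brownian_motionD(3)[OF assms(1)] that by auto
  have "path_kernel M B A i 0 = 0" if "i \<le> k" for i
    using that
  proof (induction i rule: induct_nat_012)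
    case 1
    have "(\<integral>\<omega>. indicator A (pathsup 0 (\<lambda>z. B 1 z \<omega>)) \<partial>M) = (\<integral>\<omega>. 0 \<partial>M :: real)"
      using 1 sup(1) assms(2) by (intro Bochner_Integration.integral_cong) (auto simp: indicator_def)
    then show ?case by simp
  next
    case (ge2 l)
    have "(\<integral>\<omega>. path_kernel M B A (Suc l) (pathsup 0 (\<lambda>z. \<bar>B (Suc (Suc l)) z \<omega>\<bar>)) \<partial>M) = (\<integral>\<omega>. 0 \<partial>M)"
      using ge2 sup(2) by (intro Bochner_Integration.integral_cong) auto
    then show ?case by simp
  qed simp
  then show ?thesis by simp
qed

text \<open>The reflection principle enters once, in the base case, and supplies the factor 2; later
  integrations carry it along by linearity.\<close>

lemma path_kernel_eq_rhs_kernel: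
  assumes "\<And>j. 1 \<le> j \<Longrightarrow> j \<le> k \<Longrightarrow> std_brownian_motion M (B j)"
    and "A \<in> sets borel" "A \<subseteq> {0<..}" "0 \<le> y"
  shows "path_kernel M B A k y = 2 * rhs_kernel M B A k y"
  using assms
proof (induction k arbitrary: y rule: induct_nat_012)
  case 1
  have bm: "std_brownian_motion M (B 1)" using 1 by simp
  note [measurable] = measurable_brownian_pathsup[OF bm, of "\<lambda>x. x" y] 1(2)
  have "(\<integral>\<omega>. indicator A (pathsup y (\<lambda>z. B 1 z \<omega>)) \<partial>M) = (\<integral>\<omega>. indicator {\<omega>\<in>space M. pathsup y (\<lambda>z. B 1 z \<omega>) \<in> A} \<omega> \<partial>M :: real)"
    by (intro Bochner_Integration.integral_cong) (auto simp: indicator_def)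
  also have "\<dots> = \<P>(\<omega> in M. pathsup y (\<lambda>z. B 1 z \<omega>) \<in> A)"
    by (subst Bochner_Integration.integral_indicator) (auto intro!: arg_cong[where f="measure M"])
  finally show ?case using reflection_principle[OF bm 1(4,2,3)] by simp
next
  case (ge2 k)
  let ?B = "B (Suc (Suc k))"
  have bm: "std_brownian_motion M ?B" using ge2.prems by simp
  have bm': "\<And>j. 1 \<le> j \<Longrightarrow> j \<le> Suc k \<Longrightarrow> std_brownian_motion M (B j)" using ge2.prems by simp
  interpret prob_space M using std_brownian_motionD(1)[OF bm] .
  let ?Y = "\<lambda>\<omega>. pathsup y (\<lambda>z. \<bar>?B z \<omega>\<bar>)"
  have Y: "?Y \<in> borel_measurable M" using measurable_brownian_pathsup[OF bm, of abs y] by simp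
  have K: "path_kernel M B A (Suc k) \<in> borel_measurable borel"
    by (rule path_kernel_measurable[OF bm' ge2.prems(2)])
  have IH: "path_kernel M B A (Suc k) x = 2 * rhs_kernel M B A (Suc k) x" if "0 \<le> x" for x
    using ge2.IH(2)[OF bm' ge2.prems(2,3) that] .
  have zero: "path_kernel M B A (Suc k) 0 = 0"
    by (rule path_kernel_at_0[OF bm' ge2.prems(3)])
  have "2 * rhs_kernel M B A (Suc (Suc k)) y
      = (\<integral>x. indicator {0<..} x * path_kernel M B A (Suc k) x \<partial>distr M borel (absmax B (Suc (Suc k)) y))"
    unfolding rhs_kernel.simps set_lebesgue_integral_def integral_mult_right_zero[symmetric] using IH
    by (intro Bochner_Integration.integral_cong) (auto simp: indicator_def)
  also have "distr M borel (absmax B (Suc (Suc k)) y) = distr M borel ?Y"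
    using brownian_pathsup_eq(2)[OF bm _ ge2.prems(4)] by (intro distr_cong) (auto simp: absmax_def)
  also have "(\<integral>x. indicator {0<..} x * path_kernel M B A (Suc k) x \<partial>distr M borel ?Y)
      = (\<integral>\<omega>. indicator {0<..} (?Y \<omega>) * path_kernel M B A (Suc k) (?Y \<omega>) \<partial>M)"
    using K by (intro integral_distr[OF Y]) measurable
  also have "\<dots> = (\<integral>\<omega>. path_kernel M B A (Suc k) (?Y \<omega>) \<partial>M)"
  proof (intro Bochner_Integration.integral_cong refl)
    fix \<omega>
    show "indicator {0<..} (?Y \<omega>) * path_kernel M B A (Suc k) (?Y \<omega>) = path_kernel M B A (Suc k) (?Y \<omega>)"
      using zero pathsup_nonneg[of y "\<lambda>z. \<bar>?B z \<omega>\<bar>"] by (cases "?Y \<omega> = 0") (auto simp: indicator_def)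
  qed
  finally show ?case by simp
qed simp

section \<open>Integrating out the motions one at a time\<close>

text \<open>The horizon depends only on motions with index above \<open>k\<close>, so
  \<open>B k\<close> may be replaced by an independent copy. The map \<open>\<phi>\<close> is the
  identity for the outermost motion and \<open>abs\<close> for the others.\<close>

lemma expectation_pathsup_indep:
  fixes h :: "real \<Rightarrow> real"
  assumes "prob_space M" and bm: "std_brownian_motion M (B k)"
    and ind: "indep_processes M B {1..N}" and k: "1 \<le> k" "k + m \<le> N"
    and \<phi>: "\<phi> \<in> borel_measurable borel"
    and h: "h \<in> borel_measurable borel" "\<And>x. \<bar>h x\<bar> \<le> C"
  shows "(\<integral>\<omega>. h (pathsup (pathchain (\<lambda>j z. B j z \<omega>) (Suc k) m t) (\<lambda>z. \<phi> (B k z \<omega>))) \<partial>M)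
       = (\<integral>\<omega>. (\<integral>\<omega>'. h (pathsup (pathchain (\<lambda>j z. B j z \<omega>) (Suc k) m t) (\<lambda>z. \<phi> (B k z \<omega>'))) \<partial>M) \<partial>M)"
proof -
  interpret prob_space M by fact
  let ?W = "\<Pi>\<^sub>M t\<in>{0::real..}. (borel :: real measure)"
  let ?X = "\<lambda>j \<omega>. restrict (\<lambda>t. B j t \<omega>) {0..}"
  let ?J = "{Suc k..<Suc k + m}"
  have "indep_vars (\<lambda>_. ?W) ?X {1..N}"
    using ind by (simp add: indep_processes_def)
  then have ind2: "indep_var (PiM ?J (\<lambda>_. ?W)) (\<lambda>\<omega>. restrict (\<lambda>j. ?X j \<omega>) ?J) (PiM {k} (\<lambda>_. ?W)) (\<lambda>\<omega>. restrict (\<lambda>j. ?X j \<omega>) {k})"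
    by (rule indep_var_restrict) (use k in auto)
  let ?g = "\<lambda>w. pathchain w (Suc k) m t"
  have g: "?g \<in> borel_measurable (PiM ?J (\<lambda>_. ?W))"
    by (rule measurable_pathchain) simp
  have "(\<lambda>w. w k) \<in> measurable (PiM {k} (\<lambda>_. ?W)) ?W"
    by (intro measurable_component_singleton) simp
  then have "(\<lambda>p. (?g (fst p), snd p k)) \<in> measurable (PiM ?J (\<lambda>_. ?W) \<Otimes>\<^sub>M PiM {k} (\<lambda>_. ?W)) (borel \<Otimes>\<^sub>M ?W)"
    by (intro measurable_Pair measurable_compose[OF measurable_fst g] measurable_compose[OF measurable_snd])
  from measurable_compose[OF this measurable_compose[OF measurable_pathsup[OF \<phi>] h(1)]]
  have meas: "(\<lambda>(x, w). h (pathsup (?g x) (\<lambda>z. \<phi> (w k z)))) \<in> borel_measurable (PiM ?J (\<lambda>_. ?W) \<Otimes>\<^sub>M PiM {k} (\<lambda>_. ?W))"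
    by (simp add: split_beta')
  \<comment> \<open>The chain reads only indices in \<open>?J\<close> and nonnegative times, so both
    restrictions are harmless.\<close>
  have geq: "?g (restrict (\<lambda>j. ?X j \<omega>) ?J) = ?g (\<lambda>j z. B j z \<omega>)" for \<omega>
    by (rule pathchain_cong) auto
  have "pathsup y (\<lambda>z. \<phi> (restrict (\<lambda>j. ?X j \<omega>) {k} k z)) = pathsup y (\<lambda>z. \<phi> (B k z \<omega>))" for y \<omega>
    by (rule pathsup_cong) simp
  then show ?thesis
    using expectation_indep_var[OF ind2 meas h(2)] unfolding geq by simp
qed

text \<open>Each step moves the outermost maximum of the horizon into the kernel: the kernel level
  rises by one and the chain loses one motion, until the horizon is the constant
  \<open>t\<close>.\<close>

lemma expectation_path_kernel:
  assumes M: "prob_space M" and bm: "\<And>j. j \<in> {1..Suc n} \<Longrightarrow> std_brownian_motion M (B j)"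
    and ind: "indep_processes M B {1..Suc n}" and A: "A \<in> sets borel" and m: "m \<le> n"
  shows "(\<integral>\<omega>. path_kernel M B A (Suc (n - m)) (pathchain (\<lambda>j z. B j z \<omega>) (Suc (Suc (n - m))) m t) \<partial>M)
       = path_kernel M B A (Suc n) t"
  using m
proof (induction m)
  case 0
  interpret prob_space M by fact
  show ?case by (simp add: prob_space)
next
  case (Suc m)
  \<comment> \<open>Removes truncated subtraction: since \<open>Suc m \<le> n\<close>, the two
    levels involved are \<open>Suc k\<close> and \<open>Suc (Suc k)\<close>.\<close>
  define k where "k = n - Suc m"
  have k: "n - m = Suc k" using Suc.prems by (simp add: k_def)
  have K: "path_kernel M B A (Suc k) \<in> borel_measurable borel"
    using bm A Suc.prems by (intro path_kernel_measurable) (auto simp: k_def)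
  have "\<bar>path_kernel M B A (Suc k) x\<bar> \<le> 1" for x
    using path_kernel_bounds[OF M, of B A "Suc k" x] by simp
  then have "(\<integral>\<omega>. path_kernel M B A (Suc k) (pathchain (\<lambda>j z. B j z \<omega>) (Suc (Suc k)) (Suc m) t) \<partial>M)
     = (\<integral>\<omega>. path_kernel M B A (Suc (Suc k)) (pathchain (\<lambda>j z. B j z \<omega>) (Suc (Suc (Suc k))) m t) \<partial>M)"
    unfolding pathchain.simps path_kernel.simps using Suc.prems K
    by (intro expectation_pathsup_indep[OF M bm ind, where \<phi>=abs]) (auto simp: k_def)
  also have "\<dots> = path_kernel M B A (Suc n) t"
    using Suc.IH Suc.prems unfolding k by simp
  finally show ?case unfolding k_def .
qed

theorem theorem3p1:
  fixes M :: "'a measure" and B :: "nat \<Rightarrow> real \<Rightarrow> 'a \<Rightarrow> real" and n :: nat and t :: real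
  assumes "prob_space M"
    and "n \<ge> 1"
    and "t > 0"
    and "\<And>k. k \<in> {1..n+1} \<Longrightarrow> std_brownian_motion M (B k)"
    and "indep_processes M B {1..n+1}"
  shows "\<forall>A \<in> sets borel. A \<subseteq> {0<..} \<longrightarrow>
           measure M {\<omega>\<in>space M. (SUP s\<in>{0..t}. itbm B 1 n s \<omega>) \<in> A}
             = 2 * rhs_kernel M B A (n + 1) t"
proof (intro ballI impI)
  fix A :: "real set" assume A: "A \<in> sets borel" "A \<subseteq> {0<..}"
  interpret prob_space M by fact
  have bm: "std_brownian_motion M (B k)" if "k \<in> {1..Suc n}" for k using assms(4) that by simp
  have bm1: "std_brownian_motion M (B 1)" by (rule bm) simp
  \<comment> \<open>Peeling off \<open>B 1\<close> requires at least one inner motion.\<close>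
  obtain m where n: "n = Suc m" using assms(2) by (cases n) auto
  let ?Y = "\<lambda>\<omega>. pathchain (\<lambda>j z. B j z \<omega>) 2 n t"
  let ?S = "\<lambda>\<omega>. pathsup (?Y \<omega>) (\<lambda>z. B 1 z \<omega>)"
  have sup: "(SUP s\<in>{0..t}. itbm B 1 n s \<omega>) = ?S \<omega>" if \<omega>: "\<omega> \<in> space M" for \<omega>
  proof -
    have "(SUP s\<in>{0..t}. itbm B 1 n s \<omega>) = (SUP z\<in>{0..chainmax B 2 n t \<omega>}. B 1 z \<omega>)"
      unfolding n using SUP_itbm[of t 1 m B \<omega>] assms(3) std_brownian_motionD(3,4)[OF bm \<omega>]
      by (simp add: n numeral_2_eq_2)
    also have "\<dots> = pathsup (chainmax B 2 n t \<omega>) (\<lambda>z. B 1 z \<omega>)"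
      using assms(3) std_brownian_motionD(3,4)[OF bm \<omega>]
      by (intro brownian_pathsup_eq(1)[OF bm1 \<omega>, symmetric] chainmax_nonneg) auto
    also have "chainmax B 2 n t \<omega> = ?Y \<omega>"
      using assms(3) bm \<omega> by (intro chainmax_eq_pathchain) auto
    finally show ?thesis .
  qed
  have "\<P>(\<omega> in M. (SUP s\<in>{0..t}. itbm B 1 n s \<omega>) \<in> A) = \<P>(\<omega> in M. ?S \<omega> \<in> A)"
    by (intro arg_cong[where f=prob] Collect_cong conj_cong refl) (simp only: sup)
  also have "\<dots> = (\<integral>\<omega>. indicator {\<omega>\<in>space M. ?S \<omega> \<in> A} \<omega> \<partial>M)"
    by (subst Bochner_Integration.integral_indicator) (auto intro!: arg_cong[where f=prob])
  also have "\<dots> = (\<integral>\<omega>. indicator A (?S \<omega>) \<partial>M)"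
    by (intro Bochner_Integration.integral_cong) (auto simp: indicator_def)
  \<comment> \<open>\<open>B 1\<close> is independent of the horizon, so it is averaged out first
    with the horizon held fixed.\<close>
  also have "\<dots> = (\<integral>\<omega>. path_kernel M B A (Suc 0) (?Y \<omega>) \<partial>M)"
    unfolding path_kernel.simps numeral_2_eq_2 One_nat_def using assms(5) A(1)
    by (intro expectation_pathsup_indep[where B=B and k="Suc 0" and \<phi>="\<lambda>x. x" and h="indicator A" and C=1 and N="n+1", OF assms(1) bm1[unfolded One_nat_def]]) (auto simp: indicator_def)
  \<comment> \<open>The case \<open>m = n\<close>: the motions \<open>B 2\<close>, ...,
    \<open>B (n + 1)\<close> are absorbed into the kernel in that order.\<close>
  also have "\<dots> = path_kernel M B A (Suc n) t"
    using expectation_path_kernel[where m=n and n=n and t=t and B=B, OF assms(1) bm _ A(1)] assms(5) by (simp add: numeral_2_eq_2)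
  also have "\<dots> = 2 * rhs_kernel M B A (n + 1) t"
    using path_kernel_eq_rhs_kernel[of "Suc n" M B A t] bm A assms(3) by simp
  finally show "\<P>(\<omega> in M. (SUP s\<in>{0..t}. itbm B 1 n s \<omega>) \<in> A) = 2 * rhs_kernel M B A (n + 1) t" .
qed

end
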